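(* Let $(m,r)\in\mathbb N^2$. Let $g\in\mathbb Z[X]$ be monic of degree $m$. Let $h\in\mathbb Z[X,Y]$ be such that as a polynomial in $Y$ (with coefficients in $\mathbb Z[X]$) it is monic of degree $r$. Let $Q:=\mathbb Z[X,Y]/(g,h)$. Let $N\in\mathbb N$. Then the following properties hold. (1) As an abelian group $Q$ is free of rank $mr$ having $\{X^iY^j+(g,h)\mid(i,j)\in\mathbb I_{m,r}\}$ as a $\mathbb Z$-basis. (2) For each $f\in\mathbb Z[X,Y]$ there exist unique integers $a_{i,j}(f)$ indexed by $(i,j)\in\mathbb I_{m,r}$ such that in $\mathbb Z[X,Y]$ $$f\equiv\sum_{(i,j)\in\mathbb I_{m,r}}a_{i,j}(f)X^iY^j\pmod{(g,h)}.$$ (3) If $f\in l\,\mathbb Z[X,Y]$ for some $l\in\mathbb N$, then $a_{i,j}(f)\in l\mathbb Z$ for each $(i,j)\in\mathbb I_{m,r}$. (4) Let $a\in\mathbb Z$. The abelian group $S_{m,r;a}$ is free of rank $mr$ and $\{X^iY^j+J_{m,r;a}\mid(i,j)\in\mathbb I_{m,r}\}$ is a $\mathbb Z$-basis of it. Also, $S_{m,r,N;a}$ is a free $\mathbb Z/N\mathbb Z$-module of rank $mr$ and $\{X^iY^j+J_{m,r,N;a}\mid(i,j)\in\mathbb I_{m,r}\}$ is a $\mathbb Z/N\mathbb Z$-basis of it. (5) Let $a\in\mathbb Z$. For each $f\in\mathbb Z[X,Y]$ there exist unique integers $b_{i,j}(f)\in\{0,1,\ldots,N-1\}$ indexed by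 $(i,j)\in\mathbb I_{m,r}$ such that in $\mathbb Z[X,Y]$ $$f\equiv\sum_{(i,j)\in\mathbb I_{m,r}}b_{i,j}(f)X^iY^j\pmod{J_{m,r,N;a}}.$$ (6) As an abelian group, $T_m$ is free of rank $m^2$ having $\{X^iY^j+K_m\mid(i,j)\in\mathbb I_m\}$ as a $\mathbb Z$-basis. Also, $T_{m,N}$ is a free $\mathbb Z/N\mathbb Z$-module of rank $m^2$ having $\{X^iY^j+K_{m,N}\mid(i,j)\in\mathbb I_m\}$ as a $\mathbb Z/N\mathbb Z$-basis. (7) For each $f\in\mathbb Z[X,Y]$ there exist unique integers $c_{i,j}(f)\in\{0,1,\ldots,N-1\}$ indexed by $(i,j)\in\mathbb I_m$ such that in $\mathbb Z[X,Y]$ $$f\equiv\sum_{(i,j)\in\mathbb I_m}c_{i,j}(f)X^iY^j\pmod{K_{m,N}}.$$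
   Context: $\mathbb N$ is the set of positive integers. $\mathbb I_{m,r}:=\{0,\ldots,m-1\}\times\{0,\ldots,r-1\}$ and $\mathbb I_m:=\mathbb I_{m,m}$. Ideals of $\mathbb Z[X,Y]$: $J_{m,r;a}:=(X^m-1,\,X^r+Y^r-a)$, $J_{m,r,N;a}:=(X^m-1,\,X^r+Y^r-a,\,N)$, $K_m:=(X^m-1,\,Y^m-1)$, $K_{m,N}:=(X^m-1,\,Y^m-1,\,N)$. Quotient rings: $S_{m,r;a}:=\mathbb Z[X,Y]/J_{m,r;a}$, $S_{m,r,N;a}:=\mathbb Z[X,Y]/J_{m,r,N;a}$, $T_m:=\mathbb Z[X,Y]/K_m$, $T_{m,N}:=\mathbb Z[X,Y]/K_{m,N}$. *)

theory Defs
  imports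
    "HOL-Computational_Algebra.Polynomial"
    "HOL-Algebra.Algebraic_Closure_Type"
    "HOL-Algebra.Free_Abelian_Groups"
    "HOL-Algebra.IntRing"
    "HOL-Algebra.Module"
begin

text \<open>
  The ring \<open>\<int>[X,Y]\<close> is \<open>int poly poly\<close>: the outer variable is \<open>Y\<close> and the coefficients are
  polynomials in \<open>X\<close>, so \<open>Polynomial.degree\<close> and \<open>lead_coeff\<close> are those with respect to \<open>Y\<close>,
  and \<open>g \<in> \<int>[X]\<close> is embedded as \<open>[:g:]\<close>.
\<close>

type_synonym zxy = "int poly poly"

definition ZXY :: "zxy ring"
  where "ZXY = ring_of_type_algebra"

definition varX :: zxy where "varX = [:[:0, 1:]:]"

definition varY :: zxy where "varY = [:0, 1:]"

definition Idx :: "nat \<Rightarrow> nat \<Rightarrow> (nat \<times> nat) set"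
  where "Idx m r = {0..<m} \<times> {0..<r}"

definition XY :: "nat \<times> nat \<Rightarrow> zxy"
  where "XY p = varX ^ fst p * varY ^ snd p"

definition ideal_gh :: "int poly \<Rightarrow> zxy \<Rightarrow> zxy set"
  where "ideal_gh g h = Idl\<^bsub>ZXY\<^esub> {[:g:], h}"

definition idealJ :: "nat \<Rightarrow> nat \<Rightarrow> int \<Rightarrow> zxy set"
  where "idealJ m r a = Idl\<^bsub>ZXY\<^esub> {varX ^ m - 1, varX ^ r + varY ^ r - of_int a}"

definition idealJN :: "nat \<Rightarrow> nat \<Rightarrow> nat \<Rightarrow> int \<Rightarrow> zxy set"
  where "idealJN m r N a = Idl\<^bsub>ZXY\<^esub> {varX ^ m - 1, varX ^ r + varY ^ r - of_int a, of_nat N}"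

definition idealK :: "nat \<Rightarrow> zxy set"
  where "idealK m = Idl\<^bsub>ZXY\<^esub> {varX ^ m - 1, varY ^ m - 1}"

definition idealKN :: "nat \<Rightarrow> nat \<Rightarrow> zxy set"
  where "idealKN m N = Idl\<^bsub>ZXY\<^esub> {varX ^ m - 1, varY ^ m - 1, of_nat N}"

definition ringQ :: "int poly \<Rightarrow> zxy \<Rightarrow> zxy set ring"
  where "ringQ g h = ZXY Quot ideal_gh g h"

definition ringS :: "nat \<Rightarrow> nat \<Rightarrow> int \<Rightarrow> zxy set ring"
  where "ringS m r a = ZXY Quot idealJ m r a"

definition ringSN :: "nat \<Rightarrow> nat \<Rightarrow> nat \<Rightarrow> int \<Rightarrow> zxy set ring"
  where "ringSN m r N a = ZXY Quot idealJN m r N a"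

definition ringT :: "nat \<Rightarrow> zxy set ring"
  where "ringT m = ZXY Quot idealK m"

definition ringTN :: "nat \<Rightarrow> nat \<Rightarrow> zxy set ring"
  where "ringTN m N = ZXY Quot idealKN m N"

definition int_module :: "('a, 'b) ring_scheme \<Rightarrow> (int, 'a) module"
  where "int_module A = \<lparr>carrier = carrier A, monoid.mult = monoid.mult A, one = one A,
    ring.zero = ring.zero A, ring.add = ring.add A, module.smult = (\<lambda>k x. add_pow A k x)\<rparr>"

text \<open>
  A residue class \<open>C\<close> of integers acts by any of its representatives. This is the
  \<open>\<int>/N\<int>\<close>-module structure of \<open>A\<close> whenever \<open>N\<close> annihilates \<open>A\<close>; otherwise the choice of the
  representative matters and the result need not be a module over \<open>ZFact N\<close>.
\<close>

definition zmod_module :: "('a, 'b) ring_scheme \<Rightarrow> (int set, 'a) module"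
  where "zmod_module A = \<lparr>carrier = carrier A, monoid.mult = monoid.mult A, one = one A,
    ring.zero = ring.zero A, ring.add = ring.add A, module.smult = (\<lambda>C x. add_pow A (SOME k. k \<in> C) x)\<rparr>"

text \<open>
  Bases are finite indexed families, so that the notion is also the right one over the zero ring
  \<open>\<int>/1\<int>\<close>, where the members of a basis coincide. Over a nonzero ring a basis is injective on its
  index set.
\<close>

definition module_basis ::
    "('a, 'c) ring_scheme \<Rightarrow> ('a, 'b, 'd) module_scheme \<Rightarrow> 'i set \<Rightarrow> ('i \<Rightarrow> 'b) \<Rightarrow> bool"
  where "module_basis R M I b \<longleftrightarrow>
    module R M \<and> finite I \<and> b \<in> I \<rightarrow> carrier M \<and>
    (\<forall>x\<in>carrier M. \<exists>c\<in>I \<rightarrow> carrier R. x = (\<Oplus>\<^bsub>M\<^esub>i\<in>I. c i \<odot>\<^bsub>M\<^esub> b i)) \<and>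
    (\<forall>c\<in>I \<rightarrow> carrier R. (\<Oplus>\<^bsub>M\<^esub>i\<in>I. c i \<odot>\<^bsub>M\<^esub> b i) = \<zero>\<^bsub>M\<^esub> \<longrightarrow> (\<forall>i\<in>I. c i = \<zero>\<^bsub>R\<^esub>))"

definition free_module_of_rank ::
    "('a, 'c) ring_scheme \<Rightarrow> ('a, 'b, 'd) module_scheme \<Rightarrow> nat \<Rightarrow> bool"
  where "free_module_of_rank R M n \<longleftrightarrow> (\<exists>b. module_basis R M {..<n} b)"

definition free_abelian_of_rank :: "('a, 'b) ring_scheme \<Rightarrow> nat \<Rightarrow> bool"
  where "free_abelian_of_rank A n \<longleftrightarrow>
    abelian_group A \<and> add_monoid A \<cong> free_Abelian_group {..<n}"

end

theory Submission
  imports Defs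
begin

text \<open>
  Division by the monic polynomial \<open>h\<close> in \<open>Y\<close>, followed by division of the coefficients by the
  monic polynomial \<open>g\<close> in \<open>X\<close>, leaves a remainder supported on the monomials \<open>X\<^sup>iY\<^sup>j\<close> with
  \<open>i < m\<close> and \<open>j < r\<close>. Conversely, if such a polynomial equals \<open>g u + h v\<close>, then \<open>u\<close> may be
  reduced modulo \<open>h\<close>, so that \<open>h\<close> no longer contributes; the coefficients are then multiples of
  \<open>g\<close> of degree less than \<open>m\<close>, hence zero. The ideals \<open>J\<close> and \<open>K\<close> are of this form, and adjoining
  \<open>N\<close> to an ideal with such an integral basis reduces the coordinates modulo \<open>N\<close>.
\<close>

section \<open>Ideals and quotients of rings given by a type\<close>

abbreviation type_ring :: "'a::comm_ring_1 ring"
  where "type_ring \<equiv> ring_of_type_algebra"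

lemma type_ring_simps [simp]:
  "carrier (type_ring :: 'a::comm_ring_1 ring) = UNIV"
  "x \<oplus>\<^bsub>type_ring\<^esub> y = x + y"
  "x \<otimes>\<^bsub>type_ring\<^esub> y = x * y"
  "\<zero>\<^bsub>type_ring\<^esub> = (0 :: 'a)"
  "\<one>\<^bsub>type_ring\<^esub> = (1 :: 'a)"
  by (simp_all add: ring_of_type_algebra_def)

lemma type_ring_a_inv [simp]: "\<ominus>\<^bsub>type_ring\<^esub> x = - (x :: 'a::comm_ring_1)"
proof -
  interpret cring "type_ring :: 'a ring" ..
  show ?thesis
    by (rule minus_equality) simp_all
qed

lemma type_ring_finsum:
  "finite A \<Longrightarrow> finsum type_ring f A = (sum f A :: 'a::comm_ring_1)"
proof (induction A rule: finite_induct)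
  interpret cring "type_ring :: 'a ring" ..
  case (insert x A)
  then show ?case by (simp add: Pi_def)
next
  interpret cring "type_ring :: 'a ring" ..
  case empty
  show ?case by simp
qed

lemma type_ring_add_pow: "add_pow type_ring (k::int) x = of_int k * (x :: 'a::comm_ring_1)"
proof -
  interpret cring "type_ring :: 'a ring" ..
  have nat: "add_pow type_ring (n::nat) x = of_nat n * x" for n
    by (induction n) (simp_all add: algebra_simps)
  show ?thesis
    by (cases "k \<ge> 0") (simp_all add: add_pow_int_ge add_pow_int_lt nat not_le)
qed

text \<open>Closure under negation is multiplication by \<open>-1\<close>, and commutativity makes
  absorption on one side enough.\<close>

lemma type_ring_idealI:
  fixes J :: "'a::comm_ring_1 set"
  assumes "0 \<in> J" "\<And>x y. x \<in> J \<Longrightarrow> y \<in> J \<Longrightarrow> x + y \<in> J" "\<And>c x. x \<in> J \<Longrightarrow> c * x \<in> J"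
  shows "ideal J type_ring"
proof -
  interpret cring "type_ring :: 'a ring" ..
  have "subgroup J (add_monoid type_ring)"
  proof (rule subgroup.intro)
    show "inv\<^bsub>add_monoid type_ring\<^esub> x \<in> J" if "x \<in> J" for x
      using assms(3)[OF that, of "-1"] unfolding a_inv_def[symmetric] by simp
  qed (use assms(1,2) in auto)
  then show ?thesis
    using assms(3) by (intro idealI ring_axioms) (auto simp: mult.commute)
qed

section \<open>Cosets and quotient ring of a fixed ideal\<close>

context
  fixes J :: "'a::comm_ring_1 set"
  assumes J: "ideal J type_ring"
begin

lemma type_ring_ideal_zero: "0 \<in> J"
  using additive_subgroup.zero_closed[OF ideal.axioms(1)[OF J]] by simp

lemma type_ring_ideal_add: "x \<in> J \<Longrightarrow> y \<in> J \<Longrightarrow> x + y \<in> J"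
  using additive_subgroup.a_closed[OF ideal.axioms(1)[OF J]] by simp

lemma type_ring_ideal_mult: "x \<in> J \<Longrightarrow> c * x \<in> J"
  using ideal.I_l_closed[OF J] by simp

lemma type_ring_ideal_minus: "x \<in> J \<Longrightarrow> - x \<in> J"
  using type_ring_ideal_mult[of x "-1"] by simp

lemma type_ring_ideal_diff: "x \<in> J \<Longrightarrow> y \<in> J \<Longrightarrow> x - y \<in> J"
  using type_ring_ideal_add[of x "- y"] type_ring_ideal_minus[of y] by simp

lemma type_ring_coset_eq_iff:
  "J +>\<^bsub>type_ring\<^esub> x = J +>\<^bsub>type_ring\<^esub> y \<longleftrightarrow> x - y \<in> J"
  using ring.quotient_eq_iff_same_a_r_cos[OF ring_from_type_algebra J, of x y]
  by (simp add: a_minus_def)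

lemma type_ring_coset_eq_zero_iff:
  "J +>\<^bsub>type_ring\<^esub> x = \<zero>\<^bsub>type_ring Quot J\<^esub> \<longleftrightarrow> x \<in> J"
proof -
  have "J +>\<^bsub>type_ring\<^esub> 0 = J"
    by (auto simp: a_r_coset_def r_coset_def)
  then show ?thesis
    using type_ring_coset_eq_iff[of x 0] by (simp add: FactRing_def)
qed

lemma type_ring_quotient_cring: "cring (type_ring Quot J)"
  by (rule ideal.quotient_is_cring[OF J]) (rule cring_from_type_algebra)

lemma type_ring_coset_hom:
  "ring_hom_cring type_ring (type_ring Quot J) ((+>\<^bsub>type_ring\<^esub>) J)"
  by (rule ideal.rcos_ring_hom_cring[OF J]) (rule cring_from_type_algebra)

lemma type_ring_quotient_carrier:
  "carrier (type_ring Quot J) = range ((+>\<^bsub>type_ring\<^esub>) J)"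
  by (auto simp: FactRing_def A_RCOSETS_def')

text \<open>The coset map is a homomorphism of additive groups, hence commutes with integer
  multiples. Both scalar actions used later reduce to this formula.\<close>

lemma type_ring_coset_add_pow:
  "add_pow (type_ring Quot J) (k::int) (J +>\<^bsub>type_ring\<^esub> x) = J +>\<^bsub>type_ring\<^esub> (of_int k * x)"
proof -
  interpret ring_hom_cring type_ring "type_ring Quot J" "(+>\<^bsub>type_ring\<^esub>) J"
    by (rule type_ring_coset_hom)
  have "group_hom (add_monoid type_ring) (add_monoid (type_ring Quot J)) ((+>\<^bsub>type_ring\<^esub>) J)"
    using R.add.group_axioms S.add.group_axioms ring_hom_add[OF homh]
    by (intro group_hom.intro group_hom_axioms.intro homI) simp_all
  from group_hom.hom_int_pow[OF this, of x k] show ?thesis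
    unfolding add_pow_def[symmetric] type_ring_add_pow by simp
qed

lemma type_ring_coset_finsum:
  assumes "finite A"
  shows "(\<Oplus>\<^bsub>type_ring Quot J\<^esub>i\<in>A. J +>\<^bsub>type_ring\<^esub> f i) = J +>\<^bsub>type_ring\<^esub> sum f A"
proof -
  interpret ring_hom_cring type_ring "type_ring Quot J" "(+>\<^bsub>type_ring\<^esub>) J"
    by (rule type_ring_coset_hom)
  show ?thesis
    using hom_finsum[of f A] type_ring_finsum[OF assms, of f] by (simp add: o_def)
qed

end

section \<open>Generated ideals\<close>

lemma type_ring_ideal_genideal: "ideal (Idl\<^bsub>type_ring\<^esub> S) (type_ring :: 'a::comm_ring_1 ring)"
  by (rule ring.genideal_ideal[OF ring_from_type_algebra]) simp

lemma type_ring_genideal_empty: "Idl\<^bsub>type_ring\<^esub> {} = {0 :: 'a::comm_ring_1}"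
proof -
  interpret cring "type_ring :: 'a ring" ..
  have "Idl\<^bsub>type_ring\<^esub> {} \<subseteq> {0 :: 'a}"
    by (rule genideal_minimal) (auto intro: type_ring_idealI)
  then show ?thesis
    using type_ring_ideal_zero[OF type_ring_ideal_genideal[of "{}"]] by blast
qed

text \<open>The elements congruent to a multiple of \<open>a\<close> modulo \<open>Idl S\<close>
  form an ideal containing \<open>a\<close> and \<open>S\<close>, so minimality gives the nontrivial
  inclusion. Treating one generator at a time lets membership in a finitely generated ideal be
  unfolded down to the empty generating set.\<close>

lemma type_ring_mem_genideal_insert:
  fixes a x :: "'a::comm_ring_1"
  shows "x \<in> Idl\<^bsub>type_ring\<^esub> (insert a S) \<longleftrightarrow> (\<exists>u. x - u * a \<in> Idl\<^bsub>type_ring\<^esub> S)"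
proof
  interpret cring "type_ring :: 'a ring" ..
  let ?J = "{x. \<exists>u. x - u * a \<in> Idl\<^bsub>type_ring\<^esub> S}"
  note S = type_ring_ideal_genideal[of S]
  have "ideal ?J type_ring"
  proof (rule type_ring_idealI)
    show "0 \<in> ?J"
      using type_ring_ideal_zero[OF S] by (auto intro: exI[of _ 0])
  next
    fix x y
    assume "x \<in> ?J" "y \<in> ?J"
    then obtain u v where "x - u * a \<in> Idl\<^bsub>type_ring\<^esub> S" "y - v * a \<in> Idl\<^bsub>type_ring\<^esub> S"
      by auto
    from type_ring_ideal_add[OF S this] show "x + y \<in> ?J"
      by (auto intro!: exI[of _ "u + v"] simp: algebra_simps)
  next
    fix c x
    assume "x \<in> ?J"
    then obtain u where "x - u * a \<in> Idl\<^bsub>type_ring\<^esub> S"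
      by auto
    from type_ring_ideal_mult[OF S this, of c] show "c * x \<in> ?J"
      by (auto intro!: exI[of _ "c * u"] simp: algebra_simps)
  qed
  have "a - 1 * a \<in> Idl\<^bsub>type_ring\<^esub> S"
    using type_ring_ideal_zero[OF S] by simp
  moreover have "x - 0 * a \<in> Idl\<^bsub>type_ring\<^esub> S" if "x \<in> S" for x
    using that genideal_self[of S] by auto
  ultimately have "insert a S \<subseteq> ?J"
    by blast
  with \<open>ideal ?J type_ring\<close> have "Idl\<^bsub>type_ring\<^esub> (insert a S) \<subseteq> ?J"
    by (rule genideal_minimal)
  then show "x \<in> Idl\<^bsub>type_ring\<^esub> (insert a S) \<Longrightarrow> \<exists>u. x - u * a \<in> Idl\<^bsub>type_ring\<^esub> S"
    by blast
next
  interpret cring "type_ring :: 'a ring" ..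
  note S = type_ring_ideal_genideal[of "insert a S"]
  assume "\<exists>u. x - u * a \<in> Idl\<^bsub>type_ring\<^esub> S"
  then obtain u where "x - u * a \<in> Idl\<^bsub>type_ring\<^esub> S" ..
  moreover have "Idl\<^bsub>type_ring\<^esub> S \<subseteq> Idl\<^bsub>type_ring\<^esub> (insert a S)"
    using genideal_self[of "insert a S"] by (intro genideal_minimal S) auto
  moreover have "u * a \<in> Idl\<^bsub>type_ring\<^esub> (insert a S)"
    using genideal_self[of "insert a S"] by (intro type_ring_ideal_mult[OF S]) auto
  ultimately show "x \<in> Idl\<^bsub>type_ring\<^esub> (insert a S)"
    using type_ring_ideal_add[OF S, of "x - u * a" "u * a"] by auto
qed

section \<open>Integral bases modulo an ideal\<close>

text \<open>For \<open>N = 0\<close> the second condition is linear independence over the integers,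
  since \<open>0\<close> divides only \<open>0\<close>.\<close>

definition basis_mod :: "int \<Rightarrow> 'a::comm_ring_1 set \<Rightarrow> 'i set \<Rightarrow> ('i \<Rightarrow> 'a) \<Rightarrow> bool"
  where "basis_mod N J I b \<longleftrightarrow> ideal J type_ring \<and> finite I \<and>
    (\<forall>f. \<exists>a. f - (\<Sum>i\<in>I. of_int (a i) * b i) \<in> J) \<and>
    (\<forall>a. (\<Sum>i\<in>I. of_int (a i) * b i) \<in> J \<longleftrightarrow> (\<forall>i\<in>I. N dvd a i))"

lemma basis_modD:
  assumes "basis_mod N J I b"
  shows "ideal J type_ring" "finite I"
    and "\<exists>a. f - (\<Sum>i\<in>I. of_int (a i) * b i) \<in> J"
    and "(\<Sum>i\<in>I. of_int (a i) * b i) \<in> J \<longleftrightarrow> (\<forall>i\<in>I. N dvd a i)"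
  using assms unfolding basis_mod_def by blast+

lemma sum_of_int_diff:
  fixes b :: "'i \<Rightarrow> 'a::comm_ring_1"
  shows "(\<Sum>i\<in>I. of_int (a i - c i) * b i) = (\<Sum>i\<in>I. of_int (a i) * b i) - (\<Sum>i\<in>I. of_int (c i) * b i)"
  by (simp add: algebra_simps sum_subtractf)

lemma sum_of_int_scale:
  fixes b :: "'i \<Rightarrow> 'a::comm_ring_1"
  shows "(\<Sum>i\<in>I. of_int (k * a i) * b i) = of_int k * (\<Sum>i\<in>I. of_int (a i) * b i)"
  by (simp add: sum_distrib_left mult.assoc)

text \<open>The difference of two expansions of \<open>f\<close> is a combination lying in
  \<open>J\<close>. This is the source of every uniqueness claim; for \<open>N = 0\<close> it gives
  equality of coefficients.\<close>

lemma basis_mod_coeff_cong: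
  assumes "basis_mod N J I b"
    and "f - (\<Sum>i\<in>I. of_int (a i) * b i) \<in> J" "f - (\<Sum>i\<in>I. of_int (c i) * b i) \<in> J"
    and "i \<in> I"
  shows "N dvd a i - c i"
proof -
  have "(\<Sum>i\<in>I. of_int (a i - c i) * b i) \<in> J"
    using type_ring_ideal_diff[OF basis_modD(1)[OF assms(1)] assms(3,2)]
    unfolding sum_of_int_diff by simp
  then show ?thesis
    using basis_modD(4)[OF assms(1), of "\<lambda>i. a i - c i"] assms(4) by blast
qed

text \<open>Multiplying an expansion of \<open>f\<close> by \<open>N\<close> makes all coefficients
  divisible by \<open>N\<close>. Hence \<open>N\<close> annihilates the quotient, which is what
  makes it a module over \<open>ZFact N\<close>.\<close>

lemma basis_mod_of_int_mem:
  assumes "basis_mod N J I b"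
  shows "of_int N * f \<in> J"
proof -
  have J: "ideal J type_ring"
    using basis_modD(1,2)[OF assms] by simp
  obtain a where "f - (\<Sum>i\<in>I. of_int (a i) * b i) \<in> J"
    using basis_modD(3)[OF assms] by blast
  from type_ring_ideal_mult[OF J this, of "of_int N"]
  have "of_int N * f - (\<Sum>i\<in>I. of_int (N * a i) * b i) \<in> J"
    unfolding sum_of_int_scale by (simp add: right_diff_distrib)
  moreover have "(\<Sum>i\<in>I. of_int (N * a i) * b i) \<in> J"
    using basis_modD(4)[OF assms, of "\<lambda>i. N * a i"] by simp
  ultimately show ?thesis
    using type_ring_ideal_add[OF J] by fastforce
qed

text \<open>Modulo the old ideal, any multiple \<open>w * N\<close> of the new generator is a
  combination with coefficients divisible by \<open>N\<close>, because \<open>w\<close> itself has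
  an expansion. Spanning is inherited, since the ideal only grows.\<close>

lemma basis_mod_insert:
  fixes S :: "'a::comm_ring_1 set"
  assumes "basis_mod 0 (Idl\<^bsub>type_ring\<^esub> S) I b"
  shows "basis_mod N (Idl\<^bsub>type_ring\<^esub> (insert (of_int N) S)) I b"
  unfolding basis_mod_def
proof (intro conjI allI type_ring_ideal_genideal)
  let ?J = "Idl\<^bsub>type_ring\<^esub> S"
  note mem = type_ring_mem_genideal_insert
  show "finite I"
    using basis_modD(1,2)[OF assms] by simp
  have span: "\<exists>a. f - (\<Sum>i\<in>I. of_int (a i) * b i) \<in> ?J" for f
    using basis_modD(3)[OF assms] by blast
  have indep: "\<forall>i\<in>I. a i = 0" if "(\<Sum>i\<in>I. of_int (a i) * b i) \<in> ?J" for a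
    using basis_modD(4)[OF assms, of a] that by simp
  show "\<exists>a. f - (\<Sum>i\<in>I. of_int (a i) * b i) \<in> Idl\<^bsub>type_ring\<^esub> (insert (of_int N) S)" for f
    using span[of f] by (auto simp: mem intro!: exI[of _ 0])
  fix a
  show "(\<Sum>i\<in>I. of_int (a i) * b i) \<in> Idl\<^bsub>type_ring\<^esub> (insert (of_int N) S) \<longleftrightarrow> (\<forall>i\<in>I. N dvd a i)"
  proof
    assume "(\<Sum>i\<in>I. of_int (a i) * b i) \<in> Idl\<^bsub>type_ring\<^esub> (insert (of_int N) S)"
    then obtain w where w: "(\<Sum>i\<in>I. of_int (a i) * b i) - w * of_int N \<in> ?J"
      by (auto simp: mem)
    obtain c where "w - (\<Sum>i\<in>I. of_int (c i) * b i) \<in> ?J"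
      using span by blast
    from type_ring_ideal_add[OF type_ring_ideal_genideal w
        type_ring_ideal_mult[OF type_ring_ideal_genideal this, of "of_int N"]]
    \<comment> \<open>Replacing \<open>w\<close> by its expansion brings the relation back to the
      old ideal, where independence forces \<open>a i = N * c i\<close>.\<close>
    have "(\<Sum>i\<in>I. of_int (a i - N * c i) * b i) \<in> ?J"
      by (simp only: sum_of_int_diff sum_of_int_scale) (simp add: algebra_simps)
    from indep[OF this] show "\<forall>i\<in>I. N dvd a i"
      by auto
  next
    assume "\<forall>i\<in>I. N dvd a i"
    then have "(\<Sum>i\<in>I. of_int (a i) * b i) = (\<Sum>i\<in>I. of_int (N * (a i div N)) * b i)"
      by (intro sum.cong) auto
    then have "(\<Sum>i\<in>I. of_int (a i) * b i) - (\<Sum>i\<in>I. of_int (a i div N) * b i) * of_int N = 0"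
      by (simp only: sum_of_int_scale) (simp add: mult.commute)
    then show "(\<Sum>i\<in>I. of_int (a i) * b i) \<in> Idl\<^bsub>type_ring\<^esub> (insert (of_int N) S)"
      using type_ring_ideal_zero[OF type_ring_ideal_genideal, of S] unfolding mem by metis
  qed
qed

text \<open>Rank is defined through the index set \<open>{..<n}\<close>, while the monomials are
  indexed by pairs.\<close>

lemma basis_mod_reindex:
  assumes "basis_mod N J I b" "bij_betw e K I"
  shows "basis_mod N J K (b \<circ> e)"
proof -
  have eq: "(\<Sum>k\<in>K. of_int (a (e k)) * (b \<circ> e) k) = (\<Sum>i\<in>I. of_int (a i) * b i)" for a
    using sum.reindex_bij_betw[OF assms(2), of "\<lambda>i. of_int (a i) * b i"] by simp
  \<comment> \<open>An arbitrary coefficient family on \<open>K\<close> is transported to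
    \<open>I\<close> along the inverse of \<open>e\<close>, so that the hypothesis on
    \<open>I\<close> applies to it.\<close>
  have eq': "(\<Sum>k\<in>K. of_int (a k) * (b \<circ> e) k) = (\<Sum>i\<in>I. of_int (a (inv_into K e i)) * b i)" for a
    unfolding eq[symmetric] using assms(2)
    by (intro sum.cong) (auto simp: bij_betw_def)
  have "(\<forall>i\<in>I. N dvd a (inv_into K e i)) \<longleftrightarrow> (\<forall>k\<in>K. N dvd a k)" for a
    using assms(2) by (auto simp: bij_betw_def)
  moreover have "\<exists>a. f - (\<Sum>k\<in>K. of_int (a k) * (b \<circ> e) k) \<in> J" for f
  proof -
    obtain a where "f - (\<Sum>i\<in>I. of_int (a i) * b i) \<in> J"
      using basis_modD(3)[OF assms(1)] by blast
    then show ?thesis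
      using eq[of a] by (auto intro!: exI[of _ "a \<circ> e"])
  qed
  moreover have "finite K"
    using bij_betw_finite[OF assms(2)] basis_modD(2)[OF assms(1)] by simp
  ultimately show ?thesis
    using basis_modD(1)[OF assms(1)]
      basis_modD(4)[OF assms(1), of "\<lambda>i. a (inv_into K e i)" for a]
    unfolding basis_mod_def eq' by simp
qed

text \<open>If \<open>f = l * f'\<close>, then \<open>l\<close> times an expansion of
  \<open>f'\<close> is an expansion of \<open>f\<close>, and by uniqueness it is the given
  one.\<close>

lemma basis_mod_0_coeff_dvd:
  assumes "basis_mod 0 J I b" "f - (\<Sum>i\<in>I. of_int (a i) * b i) \<in> J"
    and "of_int l dvd f" "i \<in> I"
  shows "l dvd a i"
proof -
  have J: "ideal J type_ring"
    using basis_modD(1)[OF assms(1)] .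
  obtain f' where f: "f = of_int l * f'"
    using assms(3) by (rule dvdE)
  obtain c where "f' - (\<Sum>i\<in>I. of_int (c i) * b i) \<in> J"
    using basis_modD(3)[OF assms(1)] by blast
  from type_ring_ideal_mult[OF J this, of "of_int l"]
  have "f - (\<Sum>i\<in>I. of_int (l * c i) * b i) \<in> J"
    by (simp only: sum_of_int_scale f) (simp add: algebra_simps)
  from basis_mod_coeff_cong[OF assms(1,2) this assms(4)] show ?thesis
    by simp
qed

text \<open>The extensional function space fixes the values outside \<open>I\<close>, so that
  uniqueness of the coefficients becomes uniqueness of the function \<open>a\<close>.\<close>

lemma basis_mod_0_ex1:
  assumes "basis_mod 0 J I b"
  shows "\<exists>!a. a \<in> I \<rightarrow>\<^sub>E (UNIV :: int set) \<and> f - (\<Sum>i\<in>I. of_int (a i) * b i) \<in> J"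
proof (rule ex_ex1I)
  obtain a where a: "f - (\<Sum>i\<in>I. of_int (a i) * b i) \<in> J"
    using basis_modD(3)[OF assms] by blast
  have "(\<Sum>i\<in>I. of_int (restrict a I i) * b i) = (\<Sum>i\<in>I. of_int (a i) * b i)"
    by (rule sum.cong) auto
  with a show "\<exists>a. a \<in> I \<rightarrow>\<^sub>E (UNIV :: int set) \<and> f - (\<Sum>i\<in>I. of_int (a i) * b i) \<in> J"
    by (intro exI[of _ "restrict a I"]) auto
next
  fix a c
  assume a: "a \<in> I \<rightarrow>\<^sub>E (UNIV :: int set) \<and> f - (\<Sum>i\<in>I. of_int (a i) * b i) \<in> J"
    and c: "c \<in> I \<rightarrow>\<^sub>E (UNIV :: int set) \<and> f - (\<Sum>i\<in>I. of_int (c i) * b i) \<in> J"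
  show "a = c"
  proof (rule PiE_ext[of a I "\<lambda>_. UNIV" c])
    show "a i = c i" if "i \<in> I" for i
      using basis_mod_coeff_cong[OF assms conjunct2[OF a] conjunct2[OF c] that] by simp
  qed (use a c in blast)+
qed

lemma basis_mod_pos_ex1:
  assumes "basis_mod N J I b" "N > 0"
  shows "\<exists>!a. a \<in> I \<rightarrow>\<^sub>E {0..<N} \<and> f - (\<Sum>i\<in>I. of_int (a i) * b i) \<in> J"
proof (rule ex_ex1I)
  have J: "ideal J type_ring"
    using basis_modD(1)[OF assms(1)] .
  obtain a where a: "f - (\<Sum>i\<in>I. of_int (a i) * b i) \<in> J"
    using basis_modD(3)[OF assms(1)] by blast
  \<comment> \<open>Reducing each coefficient modulo \<open>N\<close> changes the combination only
    by an element of \<open>J\<close>.\<close>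
  define c where "c = restrict (\<lambda>i. a i mod N) I"
  have "N dvd a i - c i" if "i \<in> I" for i
    using that by (simp add: c_def dvd_minus_mod)
  then have "(\<Sum>i\<in>I. of_int (a i - c i) * b i) \<in> J"
    using basis_modD(4)[OF assms(1), of "\<lambda>i. a i - c i"] by blast
  from type_ring_ideal_add[OF J a this] have "f - (\<Sum>i\<in>I. of_int (c i) * b i) \<in> J"
    by (simp only: sum_of_int_diff) simp
  then show "\<exists>a. a \<in> I \<rightarrow>\<^sub>E {0..<N} \<and> f - (\<Sum>i\<in>I. of_int (a i) * b i) \<in> J"
    using assms(2) by (intro exI[of _ c]) (auto simp: c_def)
next
  fix a c
  assume a: "a \<in> I \<rightarrow>\<^sub>E {0..<N} \<and> f - (\<Sum>i\<in>I. of_int (a i) * b i) \<in> J"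
    and c: "c \<in> I \<rightarrow>\<^sub>E {0..<N} \<and> f - (\<Sum>i\<in>I. of_int (c i) * b i) \<in> J"
  show "a = c"
  proof (rule PiE_ext[of a I "\<lambda>_. {0..<N}" c])
    fix i
    assume i: "i \<in> I"
    have "a i mod N = c i mod N"
      using basis_mod_coeff_cong[OF assms(1) conjunct2[OF a] conjunct2[OF c] i]
      by (simp add: mod_eq_dvd_iff)
    moreover have "a i \<in> {0..<N}" "c i \<in> {0..<N}"
      using a c i by auto
    ultimately show "a i = c i"
      by simp
  qed (use a c in blast)+
qed

section \<open>Modules over the integers and their residue rings\<close>

text \<open>Finite sums depend only on the additive data. Sums in \<open>int_module A\<close> and
  \<open>zmod_module A\<close> can therefore be computed in the ring \<open>A\<close>.\<close>

lemma finsum_cong_ring_reduct: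
  assumes "carrier M = carrier A" "add M = add A" "\<zero>\<^bsub>M\<^esub> = \<zero>\<^bsub>A\<^esub>"
  shows "finsum M f I = finsum A f I"
  using assms by (simp add: finsum_def finprod_def)

lemma abelian_group_ring_reduct:
  assumes "abelian_group A"
    and "carrier M = carrier A" "add M = add A" "\<zero>\<^bsub>M\<^esub> = \<zero>\<^bsub>A\<^esub>"
  shows "abelian_group M"
proof -
  interpret A: abelian_group A by fact
  show ?thesis
  proof (rule abelian_groupI)
    show "\<exists>y\<in>carrier M. y \<oplus>\<^bsub>M\<^esub> x = \<zero>\<^bsub>M\<^esub>" if "x \<in> carrier M" for x
      using that assms(2-4) A.l_neg A.a_inv_closed by auto
  qed (use assms(2-4) A.a_assoc A.a_comm in simp_all)
qed

lemma int_module_simps [simp]: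
  "carrier (int_module A) = carrier A"
  "add (int_module A) = add A"
  "\<zero>\<^bsub>int_module A\<^esub> = \<zero>\<^bsub>A\<^esub>"
  "k \<odot>\<^bsub>int_module A\<^esub> x = add_pow A k x"
  by (simp_all add: int_module_def)

lemma zmod_module_simps [simp]:
  "carrier (zmod_module A) = carrier A"
  "add (zmod_module A) = add A"
  "\<zero>\<^bsub>zmod_module A\<^esub> = \<zero>\<^bsub>A\<^esub>"
  "C \<odot>\<^bsub>zmod_module A\<^esub> x = add_pow A (SOME k. k \<in> C) x"
  by (simp_all add: zmod_module_def)

lemma (in abelian_group) int_module_is_module: "module \<Z> (int_module G)"
proof (rule moduleI)
  show "abelian_group (int_module G)"
    by (rule abelian_group_ring_reduct[OF abelian_group_axioms]) simp_all
  show "(a \<otimes>\<^bsub>\<Z>\<^esub> b) \<odot>\<^bsub>int_module G\<^esub> x = a \<odot>\<^bsub>int_module G\<^esub> (b \<odot>\<^bsub>int_module G\<^esub> x)"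
    if "x \<in> carrier (int_module G)" for a b x
    using that add.int_pow_pow[of x a b] by (simp add: mult.commute)
qed (simp_all add: int_is_cring add.int_pow_mult add.int_pow_distrib)

lemma ZFact_ZMod:
  "carrier (ZFact N) = range (ZMod N)"
  "ZMod N x \<oplus>\<^bsub>ZFact N\<^esub> ZMod N y = ZMod N (x + y)"
  "ZMod N x \<otimes>\<^bsub>ZFact N\<^esub> ZMod N y = ZMod N (x * y)"
  "\<zero>\<^bsub>ZFact N\<^esub> = ZMod N 0"
  "\<one>\<^bsub>ZFact N\<^esub> = ZMod N 1"
proof -
  have I: "ideal (Idl\<^bsub>\<Z>\<^esub> {N}) \<Z>"
    by (rule int.genideal_ideal) simp
  note hom = ideal.rcos_ring_hom[OF I]
  show "carrier (ZFact N) = range (ZMod N)"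
    by (auto simp: ZFact_def FactRing_def A_RCOSETS_def' ZMod_def)
  show "ZMod N x \<oplus>\<^bsub>ZFact N\<^esub> ZMod N y = ZMod N (x + y)"
    using ring_hom_add[OF hom, of x y] unfolding ZFact_def ZMod_def by simp
  show "ZMod N x \<otimes>\<^bsub>ZFact N\<^esub> ZMod N y = ZMod N (x * y)"
    using ring_hom_mult[OF hom, of x y] unfolding ZFact_def ZMod_def by simp
  show "\<zero>\<^bsub>ZFact N\<^esub> = ZMod N 0"
    using ring_hom_zero[OF hom int.ring_axioms ideal.quotient_is_ring[OF I]]
    unfolding ZFact_def ZMod_def by simp
  show "\<one>\<^bsub>ZFact N\<^esub> = ZMod N 1"
    using ring_hom_one[OF hom] unfolding ZFact_def ZMod_def by simp
qed

text \<open>Controls the arbitrary representative through which \<open>zmod_module\<close> lets a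
  residue class act.\<close>

lemma ZMod_some_rep: "N dvd (SOME k. k \<in> ZMod N x) - x"
proof -
  interpret ideal "Idl\<^bsub>\<Z>\<^esub> {N}" \<Z>
    by (rule int.genideal_ideal) simp
  have "x \<in> ZMod N x"
    unfolding ZMod_def by (rule a_rcos_self) simp
  then have "(SOME k. k \<in> ZMod N x) \<in> ZMod N x"
    by (rule someI)
  from rcos_zfact[OF this] show ?thesis
    by auto
qed

text \<open>Two representatives of a class differ by a multiple of \<open>N\<close>, and
  \<open>N\<close> annihilates the group, so the chosen representative may be replaced by
  \<open>k\<close>.\<close>

lemma (in abelian_group) zmod_module_smult_ZMod:
  assumes "\<And>x. x \<in> carrier G \<Longrightarrow> add_pow G N x = \<zero>" and x: "x \<in> carrier G"
  shows "ZMod N k \<odot>\<^bsub>zmod_module G\<^esub> x = add_pow G (k::int) x"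
proof -
  obtain d where "(SOME j. j \<in> ZMod N k) - k = N * d"
    using ZMod_some_rep by (rule dvdE)
  then have "(SOME j. j \<in> ZMod N k) = k + d * N"
    by (simp add: algebra_simps)
  moreover have "add_pow G (k + d * N) x = add_pow G k x"
    using x assms(1) add.int_pow_pow[of x N d]
    by (simp add: add.int_pow_mult mult.commute)
  ultimately show ?thesis
    by simp
qed

text \<open>Each scalar is written as \<open>ZMod N c\<close>; the axioms then become laws of
  integer multiples.\<close>

lemma (in abelian_group) zmod_module_is_module:
  assumes "\<And>x. x \<in> carrier G \<Longrightarrow> add_pow G (N::int) x = \<zero>"
  shows "module (ZFact N) (zmod_module G)"
proof (rule moduleI)
  interpret Z: module \<Z> "int_module G"
    by (rule int_module_is_module)
  note smult = zmod_module_smult_ZMod[OF assms]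
  show "abelian_group (zmod_module G)"
    by (rule abelian_group_ring_reduct[OF abelian_group_axioms]) simp_all
  show "cring (ZFact N)"
    by (rule ZFact_is_cring)
  show "\<one>\<^bsub>ZFact N\<^esub> \<odot>\<^bsub>zmod_module G\<^esub> x = x" if "x \<in> carrier (zmod_module G)" for x
    \<comment> \<open>The rule exposing the \<open>SOME\<close> representative is removed so that
      \<open>smult\<close> can rewrite the action by the known representative.\<close>
    using that by (simp add: smult ZFact_ZMod del: zmod_module_simps(4))
  fix C x
  assume "C \<in> carrier (ZFact N)" and x: "x \<in> carrier (zmod_module G)"
  then obtain c where c: "C = ZMod N c"
    by (auto simp: ZFact_ZMod)
  show "C \<odot>\<^bsub>zmod_module G\<^esub> x \<in> carrier (zmod_module G)"
    using x by simp
  show "C \<odot>\<^bsub>zmod_module G\<^esub> (x \<oplus>\<^bsub>zmod_module G\<^esub> y)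
      = C \<odot>\<^bsub>zmod_module G\<^esub> x \<oplus>\<^bsub>zmod_module G\<^esub> C \<odot>\<^bsub>zmod_module G\<^esub> y"
    if "y \<in> carrier (zmod_module G)" for y
    using x that Z.smult_r_distr[of c x y]
    by (simp add: c smult del: zmod_module_simps(4))
next
  interpret Z: module \<Z> "int_module G"
    by (rule int_module_is_module)
  note smult = zmod_module_smult_ZMod[OF assms]
  fix C D x
  assume x: "x \<in> carrier (zmod_module G)"
    and "C \<in> carrier (ZFact N)" "D \<in> carrier (ZFact N)"
  then obtain c d where CD: "C = ZMod N c" "D = ZMod N d"
    by (auto simp: ZFact_ZMod)
  show "(C \<oplus>\<^bsub>ZFact N\<^esub> D) \<odot>\<^bsub>zmod_module G\<^esub> x
      = C \<odot>\<^bsub>zmod_module G\<^esub> x \<oplus>\<^bsub>zmod_module G\<^esub> D \<odot>\<^bsub>zmod_module G\<^esub> x"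
    using x Z.smult_l_distr[of c d x]
    by (simp add: CD smult ZFact_ZMod del: zmod_module_simps(4))
  show "(C \<otimes>\<^bsub>ZFact N\<^esub> D) \<odot>\<^bsub>zmod_module G\<^esub> x = C \<odot>\<^bsub>zmod_module G\<^esub> (D \<odot>\<^bsub>zmod_module G\<^esub> x)"
    using x by (simp add: CD smult ZFact_ZMod add.int_pow_pow mult.commute del: zmod_module_simps(4))
qed

section \<open>From bases modulo an ideal to bases of the quotient\<close>

lemma basis_mod_int_module:
  assumes "basis_mod 0 J I b"
  shows "module_basis \<Z> (int_module (type_ring Quot J)) I (\<lambda>i. J +>\<^bsub>type_ring\<^esub> b i)"
proof -
  have J: "ideal J type_ring" and I: "finite I"
    using basis_modD(1,2)[OF assms] by simp_all
  interpret Q: cring "type_ring Quot J"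
    by (rule type_ring_quotient_cring[OF J])
  \<comment> \<open>A combination of cosets is the coset of the combination, so spanning and
    independence in the quotient become the two conditions of \<open>basis_mod\<close>.\<close>
  have comb: "(\<Oplus>\<^bsub>int_module (type_ring Quot J)\<^esub>i\<in>I. a i \<odot>\<^bsub>int_module (type_ring Quot J)\<^esub> (J +>\<^bsub>type_ring\<^esub> b i))
      = J +>\<^bsub>type_ring\<^esub> (\<Sum>i\<in>I. of_int (a i) * b i)" for a
    by (subst finsum_cong_ring_reduct[of _ "type_ring Quot J"])
      (simp_all add: type_ring_coset_add_pow[OF J] type_ring_coset_finsum[OF J I])
  show ?thesis
    unfolding module_basis_def comb
  proof (intro conjI ballI impI Q.int_module_is_module I)
    show "(\<lambda>i. J +>\<^bsub>type_ring\<^esub> b i) \<in> I \<rightarrow> carrier (int_module (type_ring Quot J))"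
      by (auto simp: type_ring_quotient_carrier[OF J])
  next
    fix x
    assume "x \<in> carrier (int_module (type_ring Quot J))"
    then obtain f where "x = J +>\<^bsub>type_ring\<^esub> f"
      by (auto simp: type_ring_quotient_carrier[OF J])
    moreover obtain a where "f - (\<Sum>i\<in>I. of_int (a i) * b i) \<in> J"
      using basis_modD(3)[OF assms] by blast
    ultimately show "\<exists>c\<in>I \<rightarrow> carrier \<Z>. x = J +>\<^bsub>type_ring\<^esub> (\<Sum>i\<in>I. of_int (c i) * b i)"
      by (auto simp: type_ring_coset_eq_iff[OF J])
  next
    fix c i
    assume "J +>\<^bsub>type_ring\<^esub> (\<Sum>i\<in>I. of_int (c i) * b i) = \<zero>\<^bsub>int_module (type_ring Quot J)\<^esub>"
      and i: "i \<in> I"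
    then have "(\<Sum>i\<in>I. of_int (c i) * b i) \<in> J"
      by (simp add: type_ring_coset_eq_zero_iff[OF J])
    then show "c i = \<zero>\<^bsub>\<Z>\<^esub>"
      using basis_modD(4)[OF assms] i by fastforce
  qed
qed

text \<open>Coefficients are handled through integer representatives \<open>a i\<close>. A class is
  zero exactly when \<open>N\<close> divides its representative, which matches the independence
  condition of \<open>basis_mod\<close>.\<close>

lemma basis_mod_zmod_module:
  assumes "basis_mod N J I b"
  shows "module_basis (ZFact N) (zmod_module (type_ring Quot J)) I (\<lambda>i. J +>\<^bsub>type_ring\<^esub> b i)"
proof -
  let ?M = "zmod_module (type_ring Quot J)"
  have J: "ideal J type_ring" and I: "finite I"
    using basis_modD(1,2)[OF assms] by simp_all
  interpret Q: cring "type_ring Quot J"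
    by (rule type_ring_quotient_cring[OF J])
  have ann: "add_pow (type_ring Quot J) N x = \<zero>\<^bsub>type_ring Quot J\<^esub>"
    if x: "x \<in> carrier (type_ring Quot J)" for x
  proof -
    obtain f where "x = J +>\<^bsub>type_ring\<^esub> f"
      using x by (auto simp: type_ring_quotient_carrier[OF J])
    then show ?thesis
      using basis_mod_of_int_mem[OF assms, of f]
      by (simp add: type_ring_coset_add_pow[OF J] type_ring_coset_eq_zero_iff[OF J])
  qed
  have smult: "ZMod N k \<odot>\<^bsub>?M\<^esub> (J +>\<^bsub>type_ring\<^esub> f) = J +>\<^bsub>type_ring\<^esub> (of_int k * f)" for k f
    using Q.zmod_module_smult_ZMod[OF ann, where x = "J +>\<^bsub>type_ring\<^esub> f"]
    by (simp add: type_ring_quotient_carrier[OF J] type_ring_coset_add_pow[OF J]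
        del: zmod_module_simps(4))
  have comb: "(\<Oplus>\<^bsub>?M\<^esub>i\<in>I. c i \<odot>\<^bsub>?M\<^esub> (J +>\<^bsub>type_ring\<^esub> b i))
      = J +>\<^bsub>type_ring\<^esub> (\<Sum>i\<in>I. of_int (a i) * b i)"
    if "\<And>i. i \<in> I \<Longrightarrow> c i = ZMod N (a i)" for a c
  proof -
    have "(\<Oplus>\<^bsub>?M\<^esub>i\<in>I. c i \<odot>\<^bsub>?M\<^esub> (J +>\<^bsub>type_ring\<^esub> b i))
        = (\<Oplus>\<^bsub>type_ring Quot J\<^esub>i\<in>I. c i \<odot>\<^bsub>?M\<^esub> (J +>\<^bsub>type_ring\<^esub> b i))"
      by (rule finsum_cong_ring_reduct) simp_all
    also have "\<dots> = (\<Oplus>\<^bsub>type_ring Quot J\<^esub>i\<in>I. J +>\<^bsub>type_ring\<^esub> (of_int (a i) * b i))"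
      by (rule Q.finsum_cong')
        (simp_all add: that smult type_ring_quotient_carrier[OF J] del: zmod_module_simps(4))
    finally show ?thesis
      by (simp add: type_ring_coset_finsum[OF J I])
  qed
  show ?thesis
    unfolding module_basis_def
  proof (intro conjI ballI impI I)
    show "module (ZFact N) ?M"
      by (rule Q.zmod_module_is_module[OF ann])
    show "(\<lambda>i. J +>\<^bsub>type_ring\<^esub> b i) \<in> I \<rightarrow> carrier ?M"
      by (auto simp: type_ring_quotient_carrier[OF J])
  next
    fix x
    assume "x \<in> carrier ?M"
    then obtain f where x: "x = J +>\<^bsub>type_ring\<^esub> f"
      by (auto simp: type_ring_quotient_carrier[OF J])
    obtain a where "f - (\<Sum>i\<in>I. of_int (a i) * b i) \<in> J"
      using basis_modD(3)[OF assms] by blast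
    then have "x = (\<Oplus>\<^bsub>?M\<^esub>i\<in>I. ZMod N (a i) \<odot>\<^bsub>?M\<^esub> (J +>\<^bsub>type_ring\<^esub> b i))"
      by (simp only: x comb type_ring_coset_eq_iff[OF J])
    then show "\<exists>c\<in>I \<rightarrow> carrier (ZFact N). x = (\<Oplus>\<^bsub>?M\<^esub>i\<in>I. c i \<odot>\<^bsub>?M\<^esub> (J +>\<^bsub>type_ring\<^esub> b i))"
      by (rule bexI[where x = "\<lambda>i. ZMod N (a i)"]) (simp add: ZFact_ZMod)
  next
    fix c i
    assume c: "c \<in> I \<rightarrow> carrier (ZFact N)" and i: "i \<in> I"
      and zero: "(\<Oplus>\<^bsub>?M\<^esub>i\<in>I. c i \<odot>\<^bsub>?M\<^esub> (J +>\<^bsub>type_ring\<^esub> b i)) = \<zero>\<^bsub>?M\<^esub>"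
    have "\<forall>i\<in>I. \<exists>k. c i = ZMod N k"
      using c by (auto simp: ZFact_ZMod)
    then obtain a where a: "\<And>i. i \<in> I \<Longrightarrow> c i = ZMod N (a i)"
      by metis
    have "(\<Sum>i\<in>I. of_int (a i) * b i) \<in> J"
      using trans[OF sym[OF comb[of c a, OF a]] zero] type_ring_coset_eq_zero_iff[OF J] by simp
    then have "N dvd a i"
      using basis_modD(4)[OF assms] i by fastforce
    then show "c i = \<zero>\<^bsub>ZFact N\<^esub>"
      using a[OF i] by (simp add: ZFact_ZMod ZMod_eq_mod)
  qed
qed

lemma basis_mod_free_module_of_rank:
  assumes "basis_mod N J I b"
  shows "free_module_of_rank (ZFact N) (zmod_module (type_ring Quot J)) (card I)"
proof -
  have "finite I"
    using basis_modD(1,2)[OF assms] by simp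
  then obtain e where "bij_betw e {..<card I} I"
    using ex_bij_betw_nat_finite[of I] by (auto simp: atLeast0LessThan)
  from basis_mod_zmod_module[OF basis_mod_reindex[OF assms this]] show ?thesis
    unfolding free_module_of_rank_def by blast
qed

text \<open>A finitely supported family \<open>c\<close> is sent to the coset of the combination
  with coefficients \<open>c\<close>. Independence makes this homomorphism injective and spanning
  makes it surjective.\<close>

lemma basis_mod_free_abelian_of_rank:
  assumes "basis_mod 0 J I b"
  shows "free_abelian_of_rank (type_ring Quot J) (card I)"
proof -
  have J: "ideal J type_ring" and "finite I"
    using basis_modD(1,2)[OF assms] by simp_all
  then obtain e where "bij_betw e {..<card I} I"
    using ex_bij_betw_nat_finite[of I] by (auto simp: atLeast0LessThan)
  from basis_mod_reindex[OF assms this]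
  obtain v where v: "basis_mod 0 J {..<card I} v"
    by blast
  interpret Q: cring "type_ring Quot J"
    by (rule type_ring_quotient_cring[OF J])
  interpret hom: ring_hom_cring type_ring "type_ring Quot J" "(+>\<^bsub>type_ring\<^esub>) J"
    by (rule type_ring_coset_hom[OF J])
  let ?F = "free_Abelian_group {..<card I}"
  define s where "s c = (\<Sum>i<card I. of_int (poly_mapping.lookup c i) * v i)" for c
  have s_diff: "s c - s d = s (c - d)" for c d
    unfolding s_def lookup_minus sum_of_int_diff ..
  have s_add: "s (c + d) = s c + s d" for c d
    unfolding s_def by (simp add: lookup_add algebra_simps sum.distrib)
  have "(\<lambda>c. J +>\<^bsub>type_ring\<^esub> s c) \<in> iso ?F (add_monoid (type_ring Quot J))"
  proof (rule isoI)
    show "(\<lambda>c. J +>\<^bsub>type_ring\<^esub> s c) \<in> hom ?F (add_monoid (type_ring Quot J))"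
      using hom.hom_add by (intro homI) (simp_all add: s_add)
    show "bij_betw (\<lambda>c. J +>\<^bsub>type_ring\<^esub> s c) (carrier ?F) (carrier (add_monoid (type_ring Quot J)))"
    proof (intro bij_betw_imageI inj_onI subset_antisym subsetI)
      fix c d
      assume c: "c \<in> carrier ?F" and d: "d \<in> carrier ?F"
        and "J +>\<^bsub>type_ring\<^esub> s c = J +>\<^bsub>type_ring\<^esub> s d"
      then have "s (c - d) \<in> J"
        by (simp add: type_ring_coset_eq_iff[OF J] s_diff)
      then have eq: "poly_mapping.lookup c i = poly_mapping.lookup d i" if "i < card I" for i
        using basis_modD(4)[OF v, of "poly_mapping.lookup (c - d)"] that
        by (simp add: s_def lookup_minus)
      show "c = d"
      proof (rule poly_mapping_eqI)
        fix i
        show "poly_mapping.lookup c i = poly_mapping.lookup d i"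
        proof (cases "i < card I")
          case False
          \<comment> \<open>Independence says nothing outside the index set; there both families
            vanish because the carrier bounds their supports.\<close>
          then have "i \<notin> Poly_Mapping.keys c" "i \<notin> Poly_Mapping.keys d"
            using c d by auto
          then show ?thesis
            by (simp add: in_keys_iff)
        qed (rule eq)
      qed
    next
      fix x
      assume "x \<in> carrier (add_monoid (type_ring Quot J))"
      then obtain f where x: "x = J +>\<^bsub>type_ring\<^esub> f"
        by (auto simp: type_ring_quotient_carrier[OF J])
      obtain a where a: "f - (\<Sum>i<card I. of_int (a i) * v i) \<in> J"
        using basis_modD(3)[OF v] by blast
      \<comment> \<open>The coefficients are cut off to \<open>0\<close> outside the index set,
        since an element of the free group needs finite support inside it.\<close>
      let ?a = "\<lambda>i. if i < card I then a i else 0"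
      have fin: "finite {i. ?a i \<noteq> 0}"
        by (rule finite_subset[of _ "{..<card I}"]) auto
      define c where "c = Abs_poly_mapping ?a"
      have lookup: "poly_mapping.lookup c i = ?a i" for i
        unfolding c_def Abs_poly_mapping_inverse[OF CollectI[of "\<lambda>f. finite {i. f i \<noteq> 0}", OF fin]] ..
      have "Poly_Mapping.keys c \<subseteq> {..<card I}"
      proof
        show "i \<in> {..<card I}" if "i \<in> Poly_Mapping.keys c" for i
          using that lookup[of i] by (cases "i < card I") (simp_all add: in_keys_iff)
      qed
      then have "c \<in> carrier ?F"
        by simp
      moreover have "s c = (\<Sum>i<card I. of_int (a i) * v i)"
        unfolding s_def by (rule sum.cong) (simp_all add: lookup)
      then have "x = J +>\<^bsub>type_ring\<^esub> s c"
        using a by (simp add: x type_ring_coset_eq_iff[OF J])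
      ultimately show "x \<in> (\<lambda>c. J +>\<^bsub>type_ring\<^esub> s c) ` carrier ?F"
        by blast
    qed (auto simp: type_ring_quotient_carrier[OF J])
  qed
  then have "?F \<cong> add_monoid (type_ring Quot J)"
    by (rule is_isoI)
  then have "add_monoid (type_ring Quot J) \<cong> ?F"
    by (rule group.iso_sym[OF group_free_Abelian_group])
  then show ?thesis
    using Q.abelian_group_axioms by (simp add: free_abelian_of_rank_def)
qed

section \<open>Two-step division in the polynomial ring\<close>

text \<open>Pseudo-division scales \<open>f\<close> by a power of the leading coefficient, which is
  \<open>1\<close> here. Positive degree of \<open>h\<close> keeps the bound strict even when the
  remainder is \<open>0\<close>.\<close>

lemma monic_division:
  fixes f h :: "'a::idom poly"
  assumes "lead_coeff h = 1" "0 < degree h"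
  obtains q s where "f = h * q + s" "degree s < degree h"
proof -
  obtain q s where qs: "pseudo_divmod f h = (q, s)"
    by (cases "pseudo_divmod f h")
  have "h \<noteq> 0"
    using assms(2) by auto
  from pseudo_divmod[OF this qs] assms show ?thesis
    by (intro that[of q s]) auto
qed

lemma XY_monom: "of_int k * XY (i, j) = monom (monom k i) j"
proof -
  have "varX ^ i = [:monom 1 i:]"
    by (simp add: varX_def monom_altdef poly_const_pow)
  moreover have "varY ^ j = monom 1 j"
    by (simp add: varY_def monom_altdef)
  ultimately show ?thesis
    by (simp add: XY_def of_int_poly smult_monom)
qed

lemma coeff_XY_sum:
  "coeff (coeff (\<Sum>p\<in>Idx m r. of_int (a p) * XY p) j) i = (if i < m \<and> j < r then a (i, j) else 0)"
proof -
  have "coeff (coeff (\<Sum>p\<in>Idx m r. of_int (a p) * XY p) j) i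
      = (\<Sum>p\<in>Idx m r. if p = (i, j) then a p else 0)"
    unfolding coeff_sum
  proof (rule sum.cong)
    fix p
    show "coeff (coeff (of_int (a p) * XY p) j) i = (if p = (i, j) then a p else 0)"
      by (cases p) (auto simp: XY_monom coeff_monom)
  qed simp
  also have "\<dots> = (if i < m \<and> j < r then a (i, j) else 0)"
    by (subst sum.delta) (auto simp: Idx_def)
  finally show ?thesis .
qed

lemma mem_ideal_gh: "f \<in> ideal_gh g h \<longleftrightarrow> (\<exists>u v. f = [:g:] * u + h * v)"
proof -
  have "f - u * [:g:] - v * h = 0 \<longleftrightarrow> f = [:g:] * u + h * v" for u v
    by (auto simp: algebra_simps)
  then show ?thesis
    by (simp add: ideal_gh_def ZXY_def type_ring_mem_genideal_insert type_ring_genideal_empty)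
qed

lemma basis_mod_ideal_gh:
  assumes g: "lead_coeff g = 1" "degree g = m" "m > 0"
    and h: "lead_coeff h = 1" "degree h = r" "r > 0"
  shows "basis_mod 0 (ideal_gh g h) (Idx m r) XY"
  unfolding basis_mod_def
proof (intro conjI allI)
  show "ideal (ideal_gh g h) type_ring"
    unfolding ideal_gh_def ZXY_def by (rule type_ring_ideal_genideal)
  show "finite (Idx m r)"
    by (simp add: Idx_def)
next
  fix f
  obtain q \<rho> where f: "f = h * q + \<rho>" and \<rho>: "degree \<rho> < r"
    using monic_division[of h f] h by auto
  have "\<exists>q s. coeff \<rho> j = g * q + s \<and> degree s < m" for j
    using monic_division[of g "coeff \<rho> j"] g by metis
  then obtain q' s where div: "\<And>j. coeff \<rho> j = g * q' j + s j" and s: "\<And>j. degree (s j) < m"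
    by metis
  \<comment> \<open>The quotients of the coefficientwise division by \<open>g\<close> are assembled
    into one polynomial in \<open>Y\<close>. Only \<open>j < r\<close> is needed, because \<rho> has
    no coefficients beyond.\<close>
  define u where "u = (\<Sum>j<r. monom (q' j) j)"
  have u: "coeff u j = (if j < r then q' j else 0)" for j
    by (auto simp: u_def coeff_sum coeff_monom)
  let ?\<sigma> = "\<Sum>p\<in>Idx m r. of_int (coeff (s (snd p)) (fst p)) * XY p"
  have \<sigma>: "coeff ?\<sigma> j = (if j < r then s j else 0)" for j
    using s[of j] by (intro poly_eqI) (auto simp: coeff_XY_sum coeff_eq_0)
  have "\<rho> - ?\<sigma> = [:g:] * u"
  proof (rule poly_eqI)
    fix j
    show "coeff (\<rho> - ?\<sigma>) j = coeff ([:g:] * u) j"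
      using div[of j] \<rho> by (cases "j < r") (simp_all add: \<sigma> u coeff_eq_0)
  qed
  then have "f - ?\<sigma> = [:g:] * u + h * q"
    by (simp add: f diff_eq_eq)
  then have "f - ?\<sigma> \<in> ideal_gh g h"
    unfolding mem_ideal_gh by blast
  then show "\<exists>a. f - (\<Sum>p\<in>Idx m r. of_int (a p) * XY p) \<in> ideal_gh g h"
    by (rule exI[of _ "\<lambda>p. coeff (s (snd p)) (fst p)"])
next
  fix a
  let ?\<sigma> = "\<Sum>p\<in>Idx m r. of_int (a p) * XY p"
  show "?\<sigma> \<in> ideal_gh g h \<longleftrightarrow> (\<forall>p\<in>Idx m r. 0 dvd a p)"
  proof
    assume "?\<sigma> \<in> ideal_gh g h"
    then obtain u v where uv: "?\<sigma> = [:g:] * u + h * v"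
      by (auto simp: mem_ideal_gh)
    obtain q w where u: "u = h * q + w" and w: "degree w < r"
      using monic_division[of h u] h by auto
    \<comment> \<open>Collects the total multiple of \<open>h\<close> after the part
      \<open>h * q\<close> of \<open>u\<close> has been moved over.\<close>
    define z where "z = v + [:g:] * q"
    have \<sigma>: "?\<sigma> = [:g:] * w + h * z"
      unfolding uv u z_def by (simp add: algebra_simps)
    \<comment> \<open>This difference equals \<open>h * z\<close>, whose degree in \<open>Y\<close>
      would be at least \<open>r\<close> if \<open>z\<close> were nonzero. So
      \<open>z = 0\<close>.\<close>
    have "degree (?\<sigma> - [:g:] * w) < r"
    proof (rule degree_diff_less)
      \<comment> \<open>\<open>degree_le\<close> yields only a non-strict bound, hence
        \<open>r - 1\<close>; positivity of \<open>r\<close> then makes it strict. The same device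
        serves for \<open>m\<close> below.\<close>
      have "coeff ?\<sigma> j = 0" if "j > r - 1" for j
      proof -
        have "\<not> j < r"
          using that by linarith
        then show ?thesis
          by (intro poly_eqI) (simp add: coeff_XY_sum)
      qed
      then have "degree ?\<sigma> \<le> r - 1"
        by (intro degree_le allI impI)
      then show "degree ?\<sigma> < r"
        using h(3) by linarith
      show "degree ([:g:] * w) < r"
        using w degree_smult_le[of g w] by simp
    qed
    then have "degree (h * z) < r"
      unfolding \<sigma> by simp
    moreover have "h \<noteq> 0"
      using h(2,3) by auto
    ultimately have "z = 0"
      using h(2) degree_mult_eq[of h z] by (cases "z = 0") auto
    have zero: "coeff ?\<sigma> j = 0" for j
    proof (rule ccontr)
      assume nz: "coeff ?\<sigma> j \<noteq> 0"
      have eq: "coeff ?\<sigma> j = g * coeff w j"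
        using \<open>z = 0\<close> by (simp add: \<sigma>)
      have "coeff (coeff ?\<sigma> j) i = 0" if "i > m - 1" for i
      proof -
        have "\<not> i < m"
          using that by linarith
        then show ?thesis
          by (simp add: coeff_XY_sum)
      qed
      then have "degree (coeff ?\<sigma> j) \<le> m - 1"
        by (intro degree_le allI impI)
      then have "degree (g * coeff w j) < m"
        using g(3) unfolding eq by linarith
      moreover have "g \<noteq> 0" "coeff w j \<noteq> 0"
        using nz unfolding eq by auto
      ultimately show False
        using g(2) by (simp add: degree_mult_eq)
    qed
    show "\<forall>p\<in>Idx m r. 0 dvd a p"
    proof
      fix p
      assume p: "p \<in> Idx m r"
      have "coeff (coeff ?\<sigma> (snd p)) (fst p) = 0"
        unfolding zero by simp
      then show "0 dvd a p"
        using p unfolding coeff_XY_sum by (auto simp: Idx_def)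
    qed
  next
    assume "\<forall>p\<in>Idx m r. 0 dvd a p"
    then have "?\<sigma> = 0"
      by simp
    also have "0 = [:g:] * 0 + h * 0"
      by simp
    finally show "?\<sigma> \<in> ideal_gh g h"
      unfolding mem_ideal_gh by blast
  qed
qed

section \<open>The ideals J and K as instances\<close>

text \<open>Kept polymorphic in the coefficients so as to cover both the generators in
  \<open>X\<close> over the integers and those in \<open>Y\<close> over polynomials in
  \<open>X\<close>. For \<open>n = 0\<close> the monomial would merge with the constant.\<close>

lemma degree_monom_plus_const:
  fixes c :: "'a::comm_ring_1"
  assumes "n > 0"
  shows "degree (monom 1 n + [:c:]) = n" "lead_coeff (monom 1 n + [:c:]) = 1"
proof -
  show "degree (monom 1 n + [:c:]) = n"
    using assms by (simp add: degree_add_eq_left degree_monom_eq)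
  then show "lead_coeff (monom 1 n + [:c:]) = 1"
    using assms by (cases n) simp_all
qed

lemma varX_power_minus_one: "varX ^ m - 1 = [:monom 1 m + [:-1:]:]"
  by (simp add: varX_def monom_altdef poly_const_pow one_pCons)

text \<open>As a polynomial in \<open>Y\<close>, the second generator has constant term
  \<open>X^r - a\<close>, so it is monic of degree \<open>r\<close>.\<close>

lemma idealJ_eq_ideal_gh:
  "idealJ m r a = ideal_gh (monom 1 m + [:-1:]) (monom 1 r + [:monom 1 r - of_int a:])"
proof -
  have "varX ^ r + varY ^ r - of_int a = monom 1 r + [:monom 1 r - of_int a:]"
    by (simp add: varX_def varY_def monom_altdef poly_const_pow of_int_poly)
  then show ?thesis
    by (simp add: idealJ_def ideal_gh_def varX_power_minus_one)
qed

text \<open>The two arguments look alike but have different types: the first is a polynomial in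
  \<open>X\<close>, the second a polynomial in \<open>Y\<close> with coefficients in
  \<open>X\<close>.\<close>

lemma idealK_eq_ideal_gh: "idealK m = ideal_gh (monom 1 m + [:-1:]) (monom 1 m + [:-1:])"
proof -
  have "[:-1:] = (-1 :: zxy)"
    by (simp add: one_pCons)
  then have "varY ^ m - 1 = monom 1 m + [:-1:]"
    by (simp add: varY_def monom_altdef)
  then show ?thesis
    by (simp add: idealK_def ideal_gh_def varX_power_minus_one)
qed

lemma basis_mod_idealJ: "m > 0 \<Longrightarrow> r > 0 \<Longrightarrow> basis_mod 0 (idealJ m r a) (Idx m r) XY"
  unfolding idealJ_eq_ideal_gh by (intro basis_mod_ideal_gh degree_monom_plus_const)

lemma basis_mod_idealK: "m > 0 \<Longrightarrow> basis_mod 0 (idealK m) (Idx m m) XY"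
  unfolding idealK_eq_ideal_gh by (intro basis_mod_ideal_gh degree_monom_plus_const)

lemma basis_mod_idealJN:
  assumes "m > 0" "r > 0"
  shows "basis_mod (int N) (idealJN m r N a) (Idx m r) XY"
  using basis_mod_insert[OF basis_mod_idealJ[OF assms, unfolded idealJ_def ZXY_def], of "int N" a]
  by (simp add: idealJN_def ZXY_def insert_commute)

lemma basis_mod_idealKN:
  assumes "m > 0"
  shows "basis_mod (int N) (idealKN m N) (Idx m m) XY"
  using basis_mod_insert[OF basis_mod_idealK[OF assms, unfolded idealK_def ZXY_def], of "int N"]
  by (simp add: idealKN_def ZXY_def insert_commute)

lemma card_Idx: "card (Idx m r) = m * r"
  by (simp add: Idx_def)

theorem lemma2p1:
  fixes m r N :: nat and g :: "int poly" and h :: "int poly poly"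
  assumes "m > 0" and "r > 0" and "N > 0"
    and "Polynomial.lead_coeff g = 1" and "Polynomial.degree g = m"
    and "Polynomial.lead_coeff h = 1" and "Polynomial.degree h = r"
  shows
    "(\<comment> \<open>(1)\<close>
      free_abelian_of_rank (ringQ g h) (m * r) \<and>
      module_basis \<Z> (int_module (ringQ g h)) (Idx m r) (\<lambda>p. ideal_gh g h +>\<^bsub>ZXY\<^esub> XY p)) \<and>
     (\<comment> \<open>(2)\<close>
      \<forall>f. \<exists>!a. a \<in> Idx m r \<rightarrow>\<^sub>E (UNIV :: int set) \<and>
        f - (\<Sum>p\<in>Idx m r. of_int (a p) * XY p) \<in> ideal_gh g h) \<and>
     (\<comment> \<open>(3)\<close>
      \<forall>f a. a \<in> Idx m r \<rightarrow>\<^sub>E (UNIV :: int set) \<and>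
        f - (\<Sum>p\<in>Idx m r. of_int (a p) * XY p) \<in> ideal_gh g h \<longrightarrow>
        (\<forall>l::nat. l > 0 \<and> of_nat l dvd f \<longrightarrow> (\<forall>p\<in>Idx m r. int l dvd a p))) \<and>
     (\<comment> \<open>(4)\<close>
      \<forall>a::int.
        free_abelian_of_rank (ringS m r a) (m * r) \<and>
        module_basis \<Z> (int_module (ringS m r a)) (Idx m r) (\<lambda>p. idealJ m r a +>\<^bsub>ZXY\<^esub> XY p) \<and>
        free_module_of_rank (ZFact (int N)) (zmod_module (ringSN m r N a)) (m * r) \<and>
        module_basis (ZFact (int N)) (zmod_module (ringSN m r N a)) (Idx m r)
          (\<lambda>p. idealJN m r N a +>\<^bsub>ZXY\<^esub> XY p)) \<and>
     (\<comment> \<open>(5)\<close>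
      \<forall>a::int. \<forall>f. \<exists>!b. b \<in> Idx m r \<rightarrow>\<^sub>E {0..<int N} \<and>
        f - (\<Sum>p\<in>Idx m r. of_int (b p) * XY p) \<in> idealJN m r N a) \<and>
     (\<comment> \<open>(6)\<close>
      free_abelian_of_rank (ringT m) (m\<^sup>2) \<and>
      module_basis \<Z> (int_module (ringT m)) (Idx m m) (\<lambda>p. idealK m +>\<^bsub>ZXY\<^esub> XY p) \<and>
      free_module_of_rank (ZFact (int N)) (zmod_module (ringTN m N)) (m\<^sup>2) \<and>
      module_basis (ZFact (int N)) (zmod_module (ringTN m N)) (Idx m m)
        (\<lambda>p. idealKN m N +>\<^bsub>ZXY\<^esub> XY p)) \<and>
     (\<comment> \<open>(7)\<close>
      \<forall>f. \<exists>!c. c \<in> Idx m m \<rightarrow>\<^sub>E {0..<int N} \<and>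
        f - (\<Sum>p\<in>Idx m m. of_int (c p) * XY p) \<in> idealKN m N)"
proof -
  note rings = ringQ_def ringS_def ringSN_def ringT_def ringTN_def
  \<comment> \<open>Leaving the second argument of \<open>Idx\<close> open lets the same rules serve
    the rectangular and the square index sets.\<close>
  note integral = basis_mod_free_abelian_of_rank[of _ "Idx m _" XY, folded ZXY_def, unfolded card_Idx]
    basis_mod_int_module[of _ _ XY, folded ZXY_def]
  note residue = basis_mod_free_module_of_rank[of _ _ "Idx m _" XY, folded ZXY_def, unfolded card_Idx]
    basis_mod_zmod_module[of _ _ _ XY, folded ZXY_def]
  note gh = basis_mod_ideal_gh[OF assms(4,5,1,6,7,2)]
  note J = basis_mod_idealJ[OF assms(1,2)]
  note JN = basis_mod_idealJN[OF assms(1,2), of N]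
  note K = basis_mod_idealK[OF assms(1)]
  note KN = basis_mod_idealKN[OF assms(1), of N]
  have N: "int N > 0"
    using assms(3) by simp
  have dvd: "int l dvd a p"
    if "a \<in> Idx m r \<rightarrow>\<^sub>E (UNIV :: int set) \<and>
        f - (\<Sum>p\<in>Idx m r. of_int (a p) * XY p) \<in> ideal_gh g h"
      "l > 0 \<and> of_nat l dvd f" "p \<in> Idx m r"
    for f a p and l :: nat
    using basis_mod_0_coeff_dvd[OF gh conjunct2[OF that(1)] _ that(3), of "int l"] that(2) by simp
  show ?thesis
    \<comment> \<open>The rank \<open>m\<^sup>2\<close> must appear as the product
      \<open>m * m\<close> given by the cardinality of \<open>Idx m m\<close>.\<close>
    unfolding rings power2_eq_square
  proof (intro conjI)
    show "\<forall>f a. a \<in> Idx m r \<rightarrow>\<^sub>E (UNIV :: int set) \<and>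
        f - (\<Sum>p\<in>Idx m r. of_int (a p) * XY p) \<in> ideal_gh g h \<longrightarrow>
        (\<forall>l::nat. l > 0 \<and> of_nat l dvd f \<longrightarrow> (\<forall>p\<in>Idx m r. int l dvd a p))"
      by (intro allI impI ballI) (rule dvd)
  qed (intro allI conjI | rule integral[OF gh] integral[OF J] integral[OF K] residue[OF JN] residue[OF KN]
        basis_mod_0_ex1[OF gh] basis_mod_pos_ex1[OF JN N] basis_mod_pos_ex1[OF KN N])+
qed

end
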